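(* Let $P$ be an $n$-element poset and let $\alpha=(\alpha_1,\dots,\alpha_k)$ be a fixed composition of $n$. Suppose that for every $\alpha$-chain $\emptyset=K_0\subset K_1\subset\cdots\subset K_k=P$ of order ideals of $P$, at least one of the subposets $K_i-K_{i-1}$ ($1\le i\le k$) is sign-balanced. Then $P$ is sign-balanced.
   Context: A labeling of an $n$-element poset $P$ is a bijection $\omega:P\to[n]=\{1,\dots,n\}$ (not necessarily order-preserving). A linear extension of $P$ is an order-preserving bijection $f:P\to[n]$. Given $\omega$, each linear extension $f$ defines the permutation $\pi(f)=a_1a_2\cdots a_n$ of $[n]$ with $a_i=\omega(f^{-1}(i))$. The poset $P$ is sign-balanced if the number of linear extensions $f$ with $\pi(f)$ an even permutation equals the number with $\pi(f)$ an odd permutation; this does not depend on the choice of $\omega$. An order ideal of $P$ is a subset $K\subseteq P$ such that $t\in K$ and $s<t$ imply $s\in K$. A composition of $n$ is a sequence $\alpha=(\alpha_1,\dots,\alpha_k)$ of positive integers with $\sum\alpha_i=n$. An $\alpha$-chain of order ideals of $P$ is a chain $\emptyset=K_0\subset K_1\subset\cdots\subset K_k=P$ of order ideals with $\#(K_i-K_{i-1})=\alpha_i$ for $1\le i\le k$. Subsets of $P$ are given the induced order. *)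

theory Defs
  imports "HOL-Combinatorics.Combinatorics" "HOL-Library.FuncSet"
begin

text \<open>
  A poset is a carrier set \<open>P\<close> with a reflexive order \<open>r\<close> such that \<^term>\<open>partial_order_on P r\<close>;
  the induced order on a subset \<open>A\<close> is \<^term>\<open>Restr r A\<close>.
\<close>

definition labeling :: "'a set \<Rightarrow> ('a \<Rightarrow> nat) \<Rightarrow> bool" where
  "labeling P \<omega> \<longleftrightarrow> bij_betw \<omega> P {1..card P}"

text \<open>Functions are made \<^const>\<open>extensional\<close> so that linear extensions can be counted.\<close>

definition linear_extensions :: "'a set \<Rightarrow> 'a rel \<Rightarrow> ('a \<Rightarrow> nat) set" where
  "linear_extensions P r =
     {f \<in> extensional P. bij_betw f P {1..card P} \<and> monotone_on P (\<lambda>s t. (s, t) \<in> r) (\<le>) f}"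

text \<open>
  The word \<open>a\<^sub>1 \<dots> a\<^sub>n\<close> with \<open>a\<^sub>i = \<omega> (f\<^sup>-\<^sup>1 i)\<close> is the permutation \<open>i \<mapsto> a\<^sub>i\<close> of
  \<open>{1..n}\<close>, extended by the identity as in the library's convention for permutations of a set.
\<close>

definition ext_perm :: "'a set \<Rightarrow> ('a \<Rightarrow> nat) \<Rightarrow> ('a \<Rightarrow> nat) \<Rightarrow> nat \<Rightarrow> nat" where
  "ext_perm P \<omega> f = restrict_id (\<lambda>i. \<omega> (inv_into P f i)) {1..card P}"

definition sign_balanced_wrt :: "'a set \<Rightarrow> 'a rel \<Rightarrow> ('a \<Rightarrow> nat) \<Rightarrow> bool" where
  "sign_balanced_wrt P r \<omega> \<longleftrightarrow>
     card {f \<in> linear_extensions P r. evenperm (ext_perm P \<omega> f)} =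
     card {f \<in> linear_extensions P r. \<not> evenperm (ext_perm P \<omega> f)}"

text \<open>
  The choice of labeling does not matter (lemma \<open>sign_balanced_iff\<close> below), and
  every finite \<open>P\<close> has one. The notion is meant for finite \<open>P\<close> only.
\<close>

definition sign_balanced :: "'a set \<Rightarrow> 'a rel \<Rightarrow> bool" where
  "sign_balanced P r \<longleftrightarrow> (\<forall>\<omega>. labeling P \<omega> \<longrightarrow> sign_balanced_wrt P r \<omega>)"

definition order_ideal :: "'a set \<Rightarrow> 'a rel \<Rightarrow> 'a set \<Rightarrow> bool" where
  "order_ideal P r K \<longleftrightarrow> K \<subseteq> P \<and> (\<forall>t\<in>K. \<forall>s\<in>P. (s, t) \<in> r \<and> s \<noteq> t \<longrightarrow> s \<in> K)"

definition composition :: "nat \<Rightarrow> nat list \<Rightarrow> bool" where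
  "composition n \<alpha> \<longleftrightarrow> (\<forall>a\<in>set \<alpha>. 0 < a) \<and> sum_list \<alpha> = n"

text \<open>
  With \<open>k = length \<alpha>\<close>, the chain is \<open>K 0, \<dots>, K k\<close>; the values \<open>K i\<close> for \<open>i > k\<close> are
  irrelevant. Lists are indexed from 0, so \<open>\<alpha> ! i\<close> is the part \<open>\<alpha>\<^sub>i\<^sub>+\<^sub>1\<close>.
\<close>

definition ideal_chain :: "'a set \<Rightarrow> 'a rel \<Rightarrow> nat list \<Rightarrow> (nat \<Rightarrow> 'a set) \<Rightarrow> bool" where
  "ideal_chain P r \<alpha> K \<longleftrightarrow>
     K 0 = {} \<and> K (length \<alpha>) = P \<and>
     (\<forall>i\<le>length \<alpha>. order_ideal P r (K i)) \<and>
     (\<forall>i<length \<alpha>. K i \<subset> K (Suc i) \<and> card (K (Suc i) - K i) = \<alpha> ! i)"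

lemma ext_perm_permutes:
  assumes "labeling P \<omega>" "f \<in> linear_extensions P r"
  shows "ext_perm P \<omega> f permutes {1..card P}"
proof -
  have "bij_betw (inv_into P f) {1..card P} P"
    using assms(2) by (auto simp: linear_extensions_def intro: bij_betw_inv_into)
  then have b: "bij_betw (\<lambda>i. \<omega> (inv_into P f i)) {1..card P} {1..card P}"
    using assms(1) bij_betw_trans unfolding labeling_def comp_def by blast
  then have "bij_betw (ext_perm P \<omega> f) {1..card P} {1..card P}"
    by (subst bij_betw_cong[where g = "\<lambda>i. \<omega> (inv_into P f i)"])
       (auto simp: ext_perm_def restrict_id_def)
  then show ?thesis
    by (rule bij_imp_permutes) (auto simp: ext_perm_def restrict_id_def)
qed

lemma evenperm_ext_perm_relabel:
  assumes "labeling P \<omega>" "labeling P \<omega>'" "f \<in> linear_extensions P r"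
  defines "\<sigma> \<equiv> restrict_id (\<lambda>i. \<omega>' (inv_into P \<omega> i)) {1..card P}"
  shows "evenperm (ext_perm P \<omega>' f) \<longleftrightarrow> evenperm \<sigma> = evenperm (ext_perm P \<omega> f)"
proof -
  have inj: "inj_on \<omega> P" and fP: "f ` P = {1..card P}"
    using assms(1,3) by (auto simp: labeling_def linear_extensions_def bij_betw_def)
  have "\<sigma> permutes {1..card P}"
  proof (rule bij_imp_permutes)
    have "bij_betw (\<lambda>i. \<omega>' (inv_into P \<omega> i)) {1..card P} {1..card P}"
      using bij_betw_trans[OF bij_betw_inv_into] assms(1,2)
      unfolding labeling_def comp_def by blast
    then show "bij_betw \<sigma> {1..card P} {1..card P}"
      by (subst bij_betw_cong[where g = "\<lambda>i. \<omega>' (inv_into P \<omega> i)"])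
         (auto simp: \<sigma>_def restrict_id_def)
  qed (auto simp: \<sigma>_def restrict_id_def)
  then have ps: "permutation \<sigma>" and pp: "permutation (ext_perm P \<omega> f)"
    using ext_perm_permutes[OF assms(1,3)] by (auto simp: permutation_permutes)
  have "ext_perm P \<omega>' f = \<sigma> \<circ> ext_perm P \<omega> f"
  proof
    fix i
    show "ext_perm P \<omega>' f i = (\<sigma> \<circ> ext_perm P \<omega> f) i"
    proof (cases "i \<in> {1..card P}")
      case True
      then have "inv_into P f i \<in> P" using fP by (metis inv_into_into)
      moreover from this have "\<omega> (inv_into P f i) \<in> {1..card P}"
        using assms(1) by (auto simp: labeling_def bij_betw_def)
      ultimately show ?thesis using True inj
        by (simp add: ext_perm_def \<sigma>_def restrict_id_def)
    next
      case False
      then show ?thesis by (auto simp: ext_perm_def \<sigma>_def restrict_id_def)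
    qed
  qed
  then show ?thesis using evenperm_comp[OF ps pp] by simp
qed

lemma sign_balanced_iff:
  assumes "labeling P \<omega>"
  shows "sign_balanced P r \<longleftrightarrow> sign_balanced_wrt P r \<omega>"
proof -
  have "sign_balanced_wrt P r \<omega>'" if w: "labeling P \<omega>'" and b: "sign_balanced_wrt P r \<omega>" for \<omega>'
  proof -
    define e where "e = evenperm (restrict_id (\<lambda>i. \<omega>' (inv_into P \<omega> i)) {1..card P})"
    have *: "evenperm (ext_perm P \<omega>' f) \<longleftrightarrow> e = evenperm (ext_perm P \<omega> f)"
      if "f \<in> linear_extensions P r" for f
      unfolding e_def by (rule evenperm_ext_perm_relabel[OF assms w that])
    show ?thesis
      using b unfolding sign_balanced_wrt_def by (cases e) (simp_all add: * cong: conj_cong)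
  qed
  then show ?thesis using assms unfolding sign_balanced_def by blast
qed

end

theory Submission
  imports Defs
begin

text \<open>
  Cutting a linear extension \<open>f\<close> of \<open>P\<close> at the partial sums of \<open>\<alpha>\<close> gives an \<open>\<alpha>\<close>-chain of order
  ideals, so by hypothesis some block \<open>D\<close> of that chain is sign-balanced. The extensions that agree
  with \<open>f\<close> outside \<open>D\<close> are exactly those obtained by rearranging \<open>D\<close> within the interval of values
  that \<open>f\<close> gives it. They correspond to the linear extensions of \<open>D\<close>, and this correspondence
  either preserves all signs or reverses all signs, because the remaining letters of the word do
  not move. Hence half of them are even (\<open>block_rearrangements_balanced\<close>).

  It remains to see that the linear extensions of \<open>P\<close> are partitioned into such families
  (\<open>card_eq_by_fibres\<close>). Rearranging one block does not change the chain
  (\<open>cut_chain_eq_of_agree_off_block\<close>). So if the sign-balanced block is chosen as a function of the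
  chain alone, then all members of a family have the same chosen block, and two extensions lie in
  the same family exactly if they have the same chain and agree outside that block.
\<close>

section \<open>Counting by fibres\<close>

lemma card_eq_by_fibres:
  assumes "finite L"
    and fib: "\<And>x. x \<in> L \<Longrightarrow> card {y \<in> L. g y = g x \<and> Q y} = card {y \<in> L. g y = g x \<and> \<not> Q y}"
  shows "card {y \<in> L. Q y} = card {y \<in> L. \<not> Q y}"
proof -
  have split: "card {y \<in> L. R y} = (\<Sum>k\<in>g ` L. card {y \<in> L. g y = k \<and> R y})" for R
  proof -
    have "(\<Sum>k\<in>g ` L. sum (\<lambda>_. 1) {y. y \<in> {y \<in> L. R y} \<and> g y = k}) = sum (\<lambda>_. 1::nat) {y \<in> L. R y}"
      using assms(1) by (intro sum.group) auto
    moreover have "{y. y \<in> {y \<in> L. R y} \<and> g y = k} = {y \<in> L. g y = k \<and> R y}" for k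
      by auto
    ultimately show ?thesis by simp
  qed
  have "(\<Sum>k\<in>g ` L. card {y \<in> L. g y = k \<and> Q y}) =
      (\<Sum>k\<in>g ` L. card {y \<in> L. g y = k \<and> \<not> Q y})"
    by (rule sum.cong) (use fib in auto)
  then show ?thesis
    by (rule trans[OF split trans[OF _ split[symmetric]]])
qed

section \<open>Linear extensions\<close>

lemma finite_linear_extensions:
  assumes "finite P"
  shows "finite (linear_extensions P r)"
proof (rule finite_subset)
  show "linear_extensions P r \<subseteq> (\<Pi>\<^sub>E x\<in>P. {1..card P})"
    by (auto simp: linear_extensions_def PiE_def bij_betw_def)
  show "finite (\<Pi>\<^sub>E x\<in>P. {1..card P})"
    using assms by (intro finite_PiE) auto
qed

lemma labeling_linear_extension:
  "f \<in> linear_extensions P r \<Longrightarrow> labeling P f"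
  by (simp add: linear_extensions_def labeling_def)

lemma linear_extension_mono:
  "\<lbrakk>f \<in> linear_extensions P r; s \<in> P; t \<in> P; (s, t) \<in> r\<rbrakk> \<Longrightarrow> f s \<le> f t"
  by (auto simp: linear_extensions_def monotone_on_def)

lemma bij_betw_block:
  assumes "bij_betw f P {1..card P}" "m + d \<le> card P"
  shows "bij_betw f {x \<in> P. m < f x \<and> f x \<le> m + d} {m + 1..m + d}"
  unfolding bij_betw_def
proof
  show "inj_on f {x \<in> P. m < f x \<and> f x \<le> m + d}"
    using assms(1) by (auto simp: bij_betw_def inj_on_def)
  show "f ` {x \<in> P. m < f x \<and> f x \<le> m + d} = {m + 1..m + d}"
  proof (intro equalityI subsetI)
    fix y assume y: "y \<in> {m + 1..m + d}"
    then have "y \<in> f ` P" using assms by (auto simp: bij_betw_def)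
    then show "y \<in> f ` {x \<in> P. m < f x \<and> f x \<le> m + d}" using y by auto
  qed auto
qed

lemma image_eq_of_agree_off:
  assumes "bij_betw f P S" "bij_betw g P S" "D \<subseteq> P" "\<And>x. x \<in> P - D \<Longrightarrow> f x = g x"
  shows "f ` D = g ` D"
proof -
  have *: "h ` D = S - h ` (P - D)" if "bij_betw h P S" for h
    using that assms(3) by (fastforce simp: bij_betw_def inj_on_def)
  have "f ` (P - D) = g ` (P - D)" using assms(4) by (intro image_cong) auto
  then show ?thesis using *[OF assms(1)] *[OF assms(2)] by simp
qed

lemma inv_into_bij_eq:
  "\<lbrakk>bij_betw f A B; x \<in> A; f x = y\<rbrakk> \<Longrightarrow> inv_into A f y = x"
  by (auto simp: bij_betw_def)

section \<open>Rearranging one block\<close>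

text \<open>
  By independence of the labeling, the given extension \<open>f0\<close> may itself serve as the labeling. The
  permutation of a rearrangement \<open>f\<close> of the block then fixes everything outside \<open>{m + 1..m + d}\<close>,
  and on this interval it is the permutation of the restriction of \<open>f\<close> to the block, shifted
  by \<open>m\<close>; a shift preserves the sign.
\<close>

lemma block_rearrangements_balanced:
  assumes w: "labeling P \<omega>" and f0: "f0 \<in> linear_extensions P r"
    and md: "m + d \<le> card P"
    and D_def: "D = {x \<in> P. m < f0 x \<and> f0 x \<le> m + d}"
    and bal: "sign_balanced D (Restr r D)"
  defines "F \<equiv> {f \<in> linear_extensions P r. \<forall>x\<in>P - D. f x = f0 x}"
  shows "card {f \<in> F. evenperm (ext_perm P \<omega> f)} = card {f \<in> F. \<not> evenperm (ext_perm P \<omega> f)}"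
proof -
  define \<phi> where "\<phi> f = (\<lambda>x\<in>D. f x - m)" for f :: "'a \<Rightarrow> nat"
  define \<psi> where "\<psi> g = (\<lambda>x. if x \<in> D then g x + m else f0 x)" for g :: "'a \<Rightarrow> nat"
  have DP: "D \<subseteq> P" by (auto simp: D_def)
  have bij0: "bij_betw f0 P {1..card P}" and ext0: "f0 \<in> extensional P"
    using f0 by (auto simp: linear_extensions_def)
  have bij0D: "bij_betw f0 D {m + 1..m + d}"
    unfolding D_def by (rule bij_betw_block[OF bij0 md])
  have cardD: "card D = d"
    using bij_betw_same_card[OF bij0D] by simp
  have shift_down: "bij_betw (\<lambda>y. y - m) {m + 1..m + d} {1..d}"
    by (rule bij_betwI[where g = "\<lambda>y. y + m"]) auto
  have shift_up: "bij_betw (\<lambda>y. y + m) {1..d} {m + 1..m + d}"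
    by (rule bij_betwI[where g = "\<lambda>y. y - m"]) auto
  have bijF: "bij_betw f P {1..card P}" if "f \<in> F" for f
    using that by (auto simp: F_def linear_extensions_def)
  have bijFD: "bij_betw f D {m + 1..m + d}" if "f \<in> F" for f
  proof -
    have "f ` D = f0 ` D"
      using that by (intro image_eq_of_agree_off[OF bijF[OF that] bij0 DP]) (auto simp: F_def)
    then show ?thesis
      using bijF[OF that] bij0D DP by (auto simp: bij_betw_def intro: inj_on_subset)
  qed
  have rangeF: "m < f x \<and> f x \<le> m + d" if "f \<in> F" "x \<in> D" for f x
    using bij_betwE[OF bijFD[OF that(1)]] that(2) by fastforce
  have \<phi>_in: "\<phi> f \<in> linear_extensions D (Restr r D)" if f: "f \<in> F" for f
  proof -
    have "bij_betw (\<phi> f) D {1..d}"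
      using bij_betw_trans[OF bijFD[OF f] shift_down]
      by (subst bij_betw_cong[where g = "(\<lambda>y. y - m) \<circ> f"]) (auto simp: \<phi>_def)
    moreover have "\<phi> f s \<le> \<phi> f t" if "s \<in> D" "t \<in> D" "(s, t) \<in> r" for s t
    proof -
      have "f s \<le> f t"
        using f that DP linear_extension_mono[of f P r s t] by (auto simp: F_def)
      then show ?thesis using that by (simp add: \<phi>_def)
    qed
    ultimately show ?thesis
      by (auto simp: linear_extensions_def monotone_on_def cardD \<phi>_def)
  qed
  have \<psi>_in: "\<psi> g \<in> F" if g: "g \<in> linear_extensions D (Restr r D)" for g
  proof -
    have bg: "bij_betw g D {1..d}"
      using g by (auto simp: linear_extensions_def cardD)
    have gr: "1 \<le> g x \<and> g x \<le> d" if "x \<in> D" for x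
      using bij_betwE[OF bg] that by auto
    have "bij_betw (\<psi> g) D {m + 1..m + d}"
      using bij_betw_trans[OF bg shift_up]
      by (subst bij_betw_cong[where g = "(\<lambda>y. y + m) \<circ> g"]) (auto simp: \<psi>_def)
    moreover have "bij_betw (\<psi> g) (P - D) ({1..card P} - {m + 1..m + d})"
    proof (subst bij_betw_cong[where g = f0])
      show "bij_betw f0 (P - D) ({1..card P} - {m + 1..m + d})"
        using DP md by (intro bij_betw_DiffI[OF bij0 bij0D]) auto
    qed (auto simp: \<psi>_def)
    ultimately have "bij_betw (\<psi> g) (D \<union> (P - D))
        ({m + 1..m + d} \<union> ({1..card P} - {m + 1..m + d}))"
      by (rule bij_betw_combine) auto
    moreover have "D \<union> (P - D) = P" using DP by auto
    moreover have "{m + 1..m + d} \<union> ({1..card P} - {m + 1..m + d}) = {1..card P}"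
      using md by auto
    ultimately have "bij_betw (\<psi> g) P {1..card P}" by simp
    moreover have "\<psi> g s \<le> \<psi> g t" if st: "s \<in> P" "t \<in> P" "(s, t) \<in> r" for s t
    proof -
      have le: "f0 s \<le> f0 t" using linear_extension_mono[OF f0 st] .
      consider "s \<in> D" "t \<in> D" | "s \<in> D" "t \<notin> D" | "s \<notin> D" "t \<in> D" | "s \<notin> D" "t \<notin> D"
        by blast
      then show ?thesis
      proof cases
        case 1
        then have "g s \<le> g t" using st by (intro linear_extension_mono[OF g]) auto
        then show ?thesis using 1 by (simp add: \<psi>_def)
      next
        \<comment> \<open>Monotonicity of \<open>f0\<close> puts an element of \<open>P - D\<close> that lies above a block element
            after the whole block, and one that lies below it before the whole block.\<close>
        case 2
        then have "m + d < f0 t" using le st unfolding D_def by auto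
        then show ?thesis using 2 gr[OF 2(1)] by (simp add: \<psi>_def)
      next
        case 3
        then have "f0 s \<le> m" using le st unfolding D_def by auto
        then show ?thesis using 3 by (simp add: \<psi>_def)
      next
        case 4
        then show ?thesis using le by (simp add: \<psi>_def)
      qed
    qed
    moreover have "\<psi> g \<in> extensional P"
      using ext0 DP by (auto simp: \<psi>_def extensional_def)
    ultimately show ?thesis
      by (auto simp: F_def linear_extensions_def monotone_on_def) (auto simp: \<psi>_def)
  qed
  have bij\<phi>: "bij_betw \<phi> F (linear_extensions D (Restr r D))"
  proof (rule bij_betw_byWitness[where f' = \<psi>])
    show "\<forall>f\<in>F. \<psi> (\<phi> f) = f"
    proof
      fix f assume f: "f \<in> F"
      show "\<psi> (\<phi> f) = f"
      proof
        fix x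
        have "f x = f0 x" if "x \<notin> P"
          using that f ext0 by (auto simp: F_def linear_extensions_def extensional_def)
        then show "\<psi> (\<phi> f) x = f x"
          using f rangeF[OF f, of x] by (cases "x \<in> P") (auto simp: \<psi>_def \<phi>_def F_def)
      qed
    qed
    show "\<forall>g\<in>linear_extensions D (Restr r D). \<phi> (\<psi> g) = g"
      by (auto simp: \<psi>_def \<phi>_def fun_eq_iff linear_extensions_def extensional_def)
  qed (use \<phi>_in \<psi>_in in auto)
  have f0F: "f0 \<in> F" using f0 by (simp add: F_def)
  have wD: "labeling D (\<phi> f0)"
    using labeling_linear_extension[OF \<phi>_in[OF f0F]] .
  have ev: "evenperm (ext_perm P f0 f) = evenperm (ext_perm D (\<phi> f0) (\<phi> f))" if f: "f \<in> F" for f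
  proof -
    have p: "ext_perm D (\<phi> f0) (\<phi> f) permutes {1..d}"
      using ext_perm_permutes[OF wD \<phi>_in[OF f]] by (simp add: cardD)
    have inj: "inj_on (\<lambda>y. y + m) {1..d}" by (auto simp: inj_on_def)
    have "ext_perm P f0 f = map_permutation {1..d} (\<lambda>y. y + m) (ext_perm D (\<phi> f0) (\<phi> f))"
      (is "?l = ?r")
    proof
      fix i
      have rperm: "?r permutes {m + 1..m + d}"
        by (rule map_permutation_permutes[OF shift_up p])
      show "?l i = ?r i"
      proof (cases "i \<in> {m + 1..m + d}")
        case True
        then have "i \<in> f ` D" unfolding bij_betw_imp_surj_on[OF bijFD[OF f]] .
        then obtain x where x: "x \<in> D" "f x = i" by (elim imageE) simp
        have i: "i - m \<in> {1..d}" "i \<in> {1..card P}" "m + (i - m) = i" using True md by auto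
        have b: "bij_betw (\<phi> f) D {1..d}"
          using \<phi>_in[OF f] by (simp add: linear_extensions_def cardD)
        have "inv_into P f i = x" using inv_into_bij_eq[OF bijF[OF f]] x DP by auto
        moreover have "inv_into D (\<phi> f) (i - m) = x"
          using x by (intro inv_into_bij_eq[OF b]) (auto simp: \<phi>_def)
        moreover have "?r i = ext_perm D (\<phi> f0) (\<phi> f) (i - m) + m"
          using map_permutation_apply[OF inj i(1)] i by (simp add: add.commute)
        ultimately show ?thesis
          using i x rangeF[OF f0F x(1)] by (simp add: ext_perm_def cardD \<phi>_def)
      next
        case False
        then have r: "?r i = i" using rperm by (simp add: permutes_not_in)
        show ?thesis
        proof (cases "i \<in> {1..card P}")
          case True
          then have "i \<in> f ` P" unfolding bij_betw_imp_surj_on[OF bijF[OF f]] .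
          then obtain x where x: "x \<in> P" "f x = i" by (elim imageE) simp
          then have "x \<notin> D" using False bij_betwE[OF bijFD[OF f]] by blast
          then have "f0 x = i" using x f by (auto simp: F_def)
          moreover have "inv_into P f i = x" using inv_into_bij_eq[OF bijF[OF f]] x by auto
          ultimately show ?thesis using True r by (simp add: ext_perm_def)
        next
          case False
          then show ?thesis using r by (simp add: ext_perm_def)
        qed
      qed
    qed
    then show ?thesis
      using evenperm_map_permutation[OF inj p] by simp
  qed
  \<comment> \<open>The sign by which the labelings \<open>\<omega>\<close> and \<open>f0\<close> differ on all extensions at once.\<close>
  define e where "e = evenperm (restrict_id (\<lambda>i. \<omega> (inv_into P f0 i)) {1..card P})"
  have evw: "evenperm (ext_perm P \<omega> f) \<longleftrightarrow> e = evenperm (ext_perm D (\<phi> f0) (\<phi> f))" if f: "f \<in> F" for f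
    using evenperm_ext_perm_relabel[OF labeling_linear_extension[OF f0] w, of f r] f ev[OF f]
    by (auto simp: e_def F_def)
  have transfer: "card {f \<in> F. R (\<phi> f)} = card {g \<in> linear_extensions D (Restr r D). R g}" for R
  proof (rule bij_betw_same_card[of \<phi>])
    show "bij_betw \<phi> {f \<in> F. R (\<phi> f)} {g \<in> linear_extensions D (Restr r D). R g}"
      using bij\<phi> by (auto simp: bij_betw_def inj_on_def)
  qed
  have "sign_balanced_wrt D (Restr r D) (\<phi> f0)"
    using bal wD by (auto simp: sign_balanced_def)
  then have "card {f \<in> F. evenperm (ext_perm D (\<phi> f0) (\<phi> f))} =
      card {f \<in> F. \<not> evenperm (ext_perm D (\<phi> f0) (\<phi> f))}"
    unfolding transfer[of "\<lambda>g. evenperm (ext_perm D (\<phi> f0) g)"]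
      transfer[of "\<lambda>g. \<not> evenperm (ext_perm D (\<phi> f0) g)"] sign_balanced_wrt_def .
  then show ?thesis
    by (cases e) (simp_all add: evw cong: conj_cong)
qed

section \<open>Chains cut out by linear extensions\<close>

definition cut_chain :: "'a set \<Rightarrow> nat list \<Rightarrow> ('a \<Rightarrow> nat) \<Rightarrow> nat \<Rightarrow> 'a set" where
  "cut_chain P \<alpha> f j = {x \<in> P. f x \<le> sum_list (take j \<alpha>)}"

lemma sum_list_take_mono:
  fixes \<alpha> :: "nat list"
  assumes "i \<le> j"
  shows "sum_list (take i \<alpha>) \<le> sum_list (take j \<alpha>)"
proof -
  have "take j \<alpha> = take i \<alpha> @ take (j - i) (drop i \<alpha>)"
    using assms by (metis le_add_diff_inverse take_add)
  then show ?thesis by simp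
qed

lemma sum_list_take_Suc:
  "i < length \<alpha> \<Longrightarrow> sum_list (take (Suc i) \<alpha>) = sum_list (take i \<alpha>) + (\<alpha> ! i :: nat)"
  by (simp add: take_Suc_conv_app_nth)

lemma sum_list_take_le: "sum_list (take i \<alpha>) \<le> sum_list (\<alpha> :: nat list)"
  using sum_list_append[of "take i \<alpha>" "drop i \<alpha>"] by simp

lemma cut_chain_block:
  assumes "i < length \<alpha>"
  shows "cut_chain P \<alpha> f (Suc i) - cut_chain P \<alpha> f i =
    {x \<in> P. sum_list (take i \<alpha>) < f x \<and> f x \<le> sum_list (take i \<alpha>) + \<alpha> ! i}"
  using assms by (auto simp: cut_chain_def sum_list_take_Suc)

lemma ideal_chain_cut_chain:
  assumes \<alpha>: "composition (card P) \<alpha>" and f: "f \<in> linear_extensions P r"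
  shows "ideal_chain P r \<alpha> (cut_chain P \<alpha> f)"
proof -
  have bij: "bij_betw f P {1..card P}" using f by (simp add: linear_extensions_def)
  have tot: "sum_list \<alpha> = card P" using \<alpha> by (simp add: composition_def)
  have range: "1 \<le> f x \<and> f x \<le> card P" if "x \<in> P" for x
    using bij_betwE[OF bij] that by auto
  have "order_ideal P r (cut_chain P \<alpha> f i)" for i
    using linear_extension_mono[OF f] by (fastforce simp: order_ideal_def cut_chain_def)
  moreover have "cut_chain P \<alpha> f i \<subset> cut_chain P \<alpha> f (Suc i) \<and>
      card (cut_chain P \<alpha> f (Suc i) - cut_chain P \<alpha> f i) = \<alpha> ! i" if i: "i < length \<alpha>" for i
  proof -
    have "sum_list (take i \<alpha>) + \<alpha> ! i \<le> card P"
      using sum_list_take_le[of "Suc i" \<alpha>] sum_list_take_Suc[OF i] tot by simp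
    then have c: "card (cut_chain P \<alpha> f (Suc i) - cut_chain P \<alpha> f i) = \<alpha> ! i"
      unfolding cut_chain_block[OF i] using bij_betw_same_card[OF bij_betw_block[OF bij]] by simp
    moreover have "0 < \<alpha> ! i" using \<alpha> i by (simp add: composition_def)
    ultimately have "cut_chain P \<alpha> f (Suc i) - cut_chain P \<alpha> f i \<noteq> {}" by (metis card.empty less_irrefl)
    moreover have "cut_chain P \<alpha> f i \<subseteq> cut_chain P \<alpha> f (Suc i)"
      using sum_list_take_mono[of i "Suc i" \<alpha>] by (auto simp: cut_chain_def)
    ultimately show ?thesis using c by auto
  qed
  moreover have "cut_chain P \<alpha> f 0 = {}" "cut_chain P \<alpha> f (length \<alpha>) = P"
    using range by (fastforce simp: cut_chain_def tot)+
  ultimately show ?thesis by (simp add: ideal_chain_def)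
qed

text \<open>
  Every cut of the chain falls at or before the start of the block, or at or after its end, so it
  does not see how the values of the block are distributed within the block.
\<close>

lemma cut_chain_eq_of_agree_off_block:
  assumes f: "bij_betw f P {1..card P}" and f0: "bij_betw f0 P {1..card P}"
    and i: "i < length \<alpha>"
    and agree: "\<And>x. x \<in> P - (cut_chain P \<alpha> f0 (Suc i) - cut_chain P \<alpha> f0 i) \<Longrightarrow> f x = f0 x"
  shows "cut_chain P \<alpha> f = cut_chain P \<alpha> f0"
proof
  fix j
  define D where "D = cut_chain P \<alpha> f0 (Suc i) - cut_chain P \<alpha> f0 i"
  have img: "f ` D = f0 ` D"
    by (rule image_eq_of_agree_off[OF f f0]) (use agree in \<open>auto simp: D_def cut_chain_def\<close>)
  have bd0: "sum_list (take i \<alpha>) < f0 x \<and> f0 x \<le> sum_list (take (Suc i) \<alpha>)" if "x \<in> D" for x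
    using that unfolding D_def cut_chain_block[OF i] by (simp add: sum_list_take_Suc[OF i])
  have bd: "sum_list (take i \<alpha>) < f x \<and> f x \<le> sum_list (take (Suc i) \<alpha>)" if "x \<in> D" for x
  proof -
    have "f x \<in> f0 ` D" using that img by blast
    then show ?thesis using bd0 by auto
  qed
  have "f x \<le> sum_list (take j \<alpha>) \<longleftrightarrow> f0 x \<le> sum_list (take j \<alpha>)" if x: "x \<in> P" for x
  proof (cases "x \<in> D")
    case True
    show ?thesis
    proof (cases "j \<le> i")
      case j: True
      show ?thesis using sum_list_take_mono[OF j, of \<alpha>] bd[OF True] bd0[OF True] by linarith
    next
      case False
      then have "Suc i \<le> j" by simp
      from sum_list_take_mono[OF this, of \<alpha>] show ?thesis using bd[OF True] bd0[OF True] by linarith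
    qed
  next
    case False
    then show ?thesis using agree x by (simp add: D_def)
  qed
  then show "cut_chain P \<alpha> f j = cut_chain P \<alpha> f0 j" by (auto simp: cut_chain_def)
qed

section \<open>Sign balance from the blocks of a chain\<close>

theorem proposition4p1:
  fixes P :: "'a set" and r :: "'a rel" and n :: nat and \<alpha> :: "nat list"
  assumes "finite P" and "card P = n" and "partial_order_on P r"
    and "composition n \<alpha>"
    and "\<And>K. ideal_chain P r \<alpha> K \<Longrightarrow>
           \<exists>i<length \<alpha>. sign_balanced (K (Suc i) - K i) (Restr r (K (Suc i) - K i))"
  shows "sign_balanced P r"
  unfolding sign_balanced_def sign_balanced_wrt_def
proof (intro allI impI)
  fix \<omega> assume w: "labeling P \<omega>"
  \<comment> \<open>The choice depends on the chain only, so that it is constant on each fibre of \<open>key\<close> below.\<close>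
  define block where
    "block K = (SOME i. i < length \<alpha> \<and> sign_balanced (K (Suc i) - K i) (Restr r (K (Suc i) - K i)))"
    for K :: "nat \<Rightarrow> 'a set"
  define D where "D K = K (Suc (block K)) - K (block K)" for K :: "nat \<Rightarrow> 'a set"
  define key where "key f = (cut_chain P \<alpha> f, restrict f (P - D (cut_chain P \<alpha> f)))"
    for f :: "'a \<Rightarrow> nat"
  have \<alpha>: "composition (card P) \<alpha>" using assms(2,4) by simp
  show "card {f \<in> linear_extensions P r. evenperm (ext_perm P \<omega> f)} =
    card {f \<in> linear_extensions P r. \<not> evenperm (ext_perm P \<omega> f)}"
  proof (rule card_eq_by_fibres[where g = key])
    show "finite (linear_extensions P r)" using finite_linear_extensions[OF assms(1)] .
    fix f0 assume f0: "f0 \<in> linear_extensions P r"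
    define K where "K = cut_chain P \<alpha> f0"
    have "\<exists>i. i < length \<alpha> \<and> sign_balanced (K (Suc i) - K i) (Restr r (K (Suc i) - K i))"
      using assms(5)[OF ideal_chain_cut_chain[OF \<alpha> f0]] by (simp add: K_def)
    from someI_ex[OF this] have i: "block K < length \<alpha>" and bal: "sign_balanced (D K) (Restr r (D K))"
      by (simp_all add: block_def[symmetric] D_def)
    define m where "m = sum_list (take (block K) \<alpha>)"
    have D_eq: "D K = {x \<in> P. m < f0 x \<and> f0 x \<le> m + \<alpha> ! block K}"
      using cut_chain_block[OF i, of P f0] by (simp add: D_def K_def m_def)
    have md: "m + \<alpha> ! block K \<le> card P"
      using sum_list_take_le[of "Suc (block K)" \<alpha>] sum_list_take_Suc[OF i] \<alpha>
      by (simp add: m_def composition_def)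
    have fibre: "key f = key f0 \<longleftrightarrow> (\<forall>x\<in>P - D K. f x = f0 x)"
      if f: "f \<in> linear_extensions P r" for f
    proof
      assume "key f = key f0"
      then have "restrict f (P - D K) = restrict f0 (P - D K)" by (auto simp: key_def K_def)
      then show "\<forall>x\<in>P - D K. f x = f0 x" by (metis restrict_apply')
    next
      assume agree: "\<forall>x\<in>P - D K. f x = f0 x"
      have "cut_chain P \<alpha> f = cut_chain P \<alpha> f0"
        by (rule cut_chain_eq_of_agree_off_block[OF _ _ i])
          (use f f0 agree in \<open>auto simp: linear_extensions_def D_def K_def\<close>)
      moreover have "restrict f (P - D K) = restrict f0 (P - D K)"
        using agree by (intro restrict_ext) auto
      ultimately show "key f = key f0" by (simp add: key_def K_def)
    qed
    show "card {f \<in> linear_extensions P r. key f = key f0 \<and> evenperm (ext_perm P \<omega> f)} =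
      card {f \<in> linear_extensions P r. key f = key f0 \<and> \<not> evenperm (ext_perm P \<omega> f)}"
      using block_rearrangements_balanced[OF w f0 md D_eq bal]
      by (simp add: fibre conj_assoc cong: conj_cong)
  qed
qed

end
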